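(* (1) A connected finite simple graph $G$ has the property that every connected induced subgraph of $G$ is antipodal if and only if $G$ is $P_1$ or $P_2$. (2) Every connected finite simple graph is an induced subgraph of some antipodal graph; that is, the minimal hereditary superclass of the class of antipodal graphs contains all connected graphs.
   Context: An antipode of a vertex $v$ of a connected graph is a vertex at maximum distance from $v$. A graph is antipodal if it is connected and every vertex has exactly one antipode. $P_1$ and $P_2$ denote the paths on one and two vertices. A class is hereditary if it is closed under taking induced subgraphs. *)

theory Defs
  imports "Graph_Theory.Graph_Theory"
begin

text \<open>
  Finite simple graphs are the graphs satisfying \<open>pair_graph\<close>: finite, loop-free, symmetric
  digraphs whose arcs are ordered pairs of vertices.  Note that \<open>connected\<close> excludes the null graph.
\<close>

definition graph_dist :: "'a pair_pre_digraph \<Rightarrow> 'a \<Rightarrow> 'a \<Rightarrow> ereal" where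
  "graph_dist G u v = wf_digraph.\<mu> (with_proj G) (\<lambda>_. 1) u v"

text \<open>
  The vertex \<open>v\<close> itself is not excluded, so that the unique vertex of the one-vertex graph
  is its own antipode.
\<close>
definition antipode :: "'a pair_pre_digraph \<Rightarrow> 'a \<Rightarrow> 'a \<Rightarrow> bool" where
  "antipode G v w \<longleftrightarrow>
     w \<in> pverts G \<and> (\<forall>x \<in> pverts G. graph_dist G v x \<le> graph_dist G v w)"

definition antipodal_graph :: "'a pair_pre_digraph \<Rightarrow> bool" where
  "antipodal_graph G \<longleftrightarrow>
     pair_graph G \<and> connected (with_proj G) \<and> (\<forall>v \<in> pverts G. \<exists>!w. antipode G v w)"

definition path_graph :: "nat \<Rightarrow> nat pair_pre_digraph" where
  "path_graph n =
     \<lparr> pverts = {..<n}, parcs = {(i, j). i < n \<and> j < n \<and> (j = Suc i \<or> i = Suc j)} \<rparr>"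

text \<open>
  For a class \<open>\<C>\<close>, the minimal hereditary superclass of \<open>\<C>\<close> is \<open>hereditary hull \<C>\<close>, the
  intersection of all hereditary superclasses.
\<close>
definition hereditary :: "'a pair_pre_digraph set \<Rightarrow> bool" where
  "hereditary \<C> \<longleftrightarrow>
     (\<forall>G \<in> \<C>. \<forall>H. induced_subgraph (with_proj H) (with_proj G) \<longrightarrow> H \<in> \<C>)"

lemma hereditary_hull: "hereditary (hereditary hull \<C>)"
  by (rule hull_in) (auto simp: hereditary_def)

end

theory Submission
  imports Defs
begin

text \<open>
  (1) A connected graph on at least three vertices has a vertex \<open>u\<close> with two neighbours \<open>v\<close>, \<open>w\<close>.
  The subgraph induced by \<open>{u, v, w}\<close> is connected, but both \<open>v\<close> and \<open>w\<close> are antipodes of \<open>u\<close>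
  in it.

  (2) For a graph \<open>R\<close> on \<open>Y\<close>, the graph on \<open>Y \<times> {0, 1}\<close> in which \<open>(x, b)\<close> and \<open>(y, c)\<close>
  (\<open>x \<noteq> y\<close>) are adjacent iff either \<open>b = c\<close> and \<open>R x y\<close>, or \<open>b \<noteq> c\<close> and not \<open>R x y\<close>, never has a
  walk of length at most 2 from \<open>(x, b)\<close> to \<open>(x, 1 - b)\<close>.  It is antipodal as soon as all other
  distances are at most 2, which can be achieved by first enlarging the given graph: attach a
  pendant vertex to every vertex, join all pendant vertices to each other, and add an apex
  joined to all the original vertices.
\<close>

section \<open>Distances\<close>

lemma graph_dist_le_walk:
  assumes "pair_wf_digraph G" "pre_digraph.awalk (with_proj G) u p v"
  shows "graph_dist G u v \<le> ereal (real (length p))"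
proof -
  interpret pair_wf_digraph G by fact
  have "\<mu> (\<lambda>_. 1) u v \<le> ereal (awalk_cost (\<lambda>_. 1) p)"
    using assms(2) by (rule min_cost_le_walk_cost)
  then show ?thesis
    by (simp add: graph_dist_def awalk_cost_def sum_list_triv)
qed

text \<open>The distance is an infimum over all walks, infinite if there are none, so a bound valid
  for every walk length passes to it.\<close>

lemma graph_dist_ge:
  assumes "pair_wf_digraph G"
    and "\<And>p. pre_digraph.awalk (with_proj G) u p v \<Longrightarrow> k \<le> length p"
  shows "ereal (real k) \<le> graph_dist G u v"
proof -
  interpret pair_wf_digraph G by fact
  show ?thesis
    using assms(2) unfolding graph_dist_def \<mu>_def awalk_cost_def
    by (auto intro!: INF_greatest simp: sum_list_triv)
qed

lemma graph_dist_self_le: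
  assumes "pair_wf_digraph G" "u \<in> pverts G"
  shows "graph_dist G u u \<le> 0"
proof -
  interpret pair_wf_digraph G by fact
  have "awalk u [] u" using assms(2) by (simp add: awalk_Nil_iff)
  from graph_dist_le_walk[OF assms(1) this] show ?thesis by (simp add: zero_ereal_def)
qed

lemma graph_dist_adj_le:
  assumes "pair_wf_digraph G" "(u, v) \<in> parcs G"
  shows "graph_dist G u v \<le> 1"
proof -
  interpret pair_wf_digraph G by fact
  have "awalk u [(u, v)] v"
    using assms(2) by (auto simp: awalk_Cons_iff awalk_Nil_iff wellformed')
  from graph_dist_le_walk[OF assms(1) this] show ?thesis by (simp add: one_ereal_def)
qed

lemma graph_dist_common_neighbour_le:
  assumes "pair_wf_digraph G" "(u, x) \<in> parcs G" "(x, v) \<in> parcs G"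
  shows "graph_dist G u v \<le> 2"
proof -
  interpret pair_wf_digraph G by fact
  have "awalk u [(u, x), (x, v)] v"
    using assms(2,3) by (auto simp: awalk_Cons_iff awalk_Nil_iff wellformed')
  from graph_dist_le_walk[OF assms(1) this] show ?thesis by simp
qed

lemma graph_dist_ge_1:
  assumes "pair_wf_digraph G" "u \<noteq> v"
  shows "1 \<le> graph_dist G u v"
proof -
  interpret pair_wf_digraph G by fact
  have "1 \<le> length p" if "awalk u p v" for p
    using that assms(2) by (cases p) (auto simp: awalk_Nil_iff)
  from graph_dist_ge[OF assms(1) this] show ?thesis by (simp add: one_ereal_def)
qed

text \<open>A walk with at most two arcs is empty, a single arc, or two arcs through a common
  neighbour; each hypothesis rules out one of these shapes.\<close>

lemma graph_dist_ge_3: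
  assumes "pair_wf_digraph G" "u \<noteq> v" "(u, v) \<notin> parcs G"
    and "\<And>x. (u, x) \<in> parcs G \<Longrightarrow> (x, v) \<notin> parcs G"
  shows "3 \<le> graph_dist G u v"
proof -
  interpret pair_wf_digraph G by fact
  have "3 \<le> length p" if "awalk u p v" for p
  proof (rule ccontr)
    assume "\<not> 3 \<le> length p"
    then consider "p = []" | e where "p = [e]" | e f where "p = [e, f]"
      by (cases p; cases "tl p"; cases "tl (tl p)") auto
    then show False
      using that assms(2-4)
      by cases (auto simp: awalk_Cons_iff awalk_Nil_iff)
  qed
  from graph_dist_ge[OF assms(1) this] show ?thesis by simp
qed


section \<open>Connectedness and induced subgraphs\<close>

lemma pair_graphI:
  assumes "finite (pverts G)" "parcs G \<subseteq> pverts G \<times> pverts G" "irrefl (parcs G)" "sym (parcs G)"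
  shows "pair_graph G"
proof -
  have "finite (parcs G)" using assms(1,2) by (meson finite_SigmaI finite_subset)
  moreover have "fst e \<in> pverts G" "snd e \<in> pverts G" "fst e \<noteq> snd e" if "e \<in> parcs G" for e
    using that assms(2,3) by (cases e, auto simp: irrefl_def)+
  moreover have "symmetric (with_proj G)" using assms(4) by (simp add: symmetric_def)
  ultimately show ?thesis using assms(1) by unfold_locales
qed

lemma pair_graph_wf: "pair_graph G \<Longrightarrow> pair_wf_digraph G"
  by (simp add: pair_graph_def pair_digraph_def pair_fin_digraph_def)

text \<open>\<open>connected\<close> asks for reachability in the symmetric closure; the arcs of a
  \<open>pair_graph\<close> are already symmetric, so plain reachability is the same.\<close>

lemma pair_graph_connected_iff:
  assumes "pair_graph G"
  shows "connected (with_proj G) \<longleftrightarrow>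
    pverts G \<noteq> {} \<and> (\<forall>u \<in> pverts G. \<forall>v \<in> pverts G. u \<rightarrow>\<^sup>*\<^bsub>with_proj G\<^esub> v)"
proof -
  interpret pair_graph G by fact
  show ?thesis
    unfolding connected_def strongly_connected_def
    by (simp add: reachable_mk_symmetric_eq[OF sym_arcs])
qed

text \<open>If no arc left \<open>S\<close>, induction along a walk starting in \<open>S\<close>
  would keep its endpoint in \<open>S\<close>, contradicting the choice of \<open>y\<close>.\<close>

lemma connected_neighbour_outside:
  assumes "pair_graph G" "connected (with_proj G)"
    and "S \<subseteq> pverts G" "S \<noteq> {}" "S \<noteq> pverts G"
  obtains u v where "u \<in> S" "v \<in> pverts G - S" "(u, v) \<in> parcs G"
proof -
  interpret pair_graph G by fact
  obtain x y where xy: "x \<in> S" "y \<in> pverts G" "y \<notin> S" using assms(3-5) by blast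
  then have "x \<rightarrow>\<^sup>*\<^bsub>with_proj G\<^esub> y"
    using assms(1-3) pair_graph_connected_iff by blast
  then have "y \<in> S" if "\<And>u v. u \<in> S \<Longrightarrow> v \<in> pverts G - S \<Longrightarrow> (u, v) \<notin> parcs G"
    using xy(1)
  proof (induction rule: reachable_induct)
    case (step a b)
    then show ?case using that[of a b] by (auto simp: wellformed')
  qed
  then show thesis using that xy by blast
qed

lemma induced_with_proj_iff:
  assumes "pair_wf_digraph G"
  shows "induced_subgraph (with_proj H) (with_proj G) \<longleftrightarrow>
    pverts H \<subseteq> pverts G \<and> parcs H = parcs G \<inter> pverts H \<times> pverts H"
proof -
  \<comment> \<open>Well-formedness of \<open>H\<close> is part of being a subgraph; here it is
    recovered from the equation for the arcs, so the set conditions alone suffice.\<close>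
  have "pair_wf_digraph H" if "parcs H = parcs G \<inter> pverts H \<times> pverts H"
  proof
    fix e assume "e \<in> parcs H"
    then have "e \<in> pverts H \<times> pverts H" using that by blast
    then show "fst e \<in> pverts H" "snd e \<in> pverts H" by auto
  qed
  moreover have "{e \<in> parcs G. fst e \<in> pverts H \<and> snd e \<in> pverts H} =
      parcs G \<inter> pverts H \<times> pverts H"
    by auto
  ultimately show ?thesis
    using assms
    unfolding induced_subgraph_def subgraph_def compatible_def wf_digraph_wp_iff with_proj_simps
    by blast
qed

lemma induced_pair_graph:
  assumes "pair_graph G" "induced_subgraph (with_proj H) (with_proj G)"
  shows "pair_graph H"
proof -
  interpret pair_graph G by fact
  have H: "pverts H \<subseteq> pverts G" "parcs H = parcs G \<inter> pverts H \<times> pverts H"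
    using assms(2) by (simp_all add: induced_with_proj_iff[OF pair_wf_digraph])
  show ?thesis
  proof (rule pair_graphI)
    show "finite (pverts H)" using H(1) pair_finite_verts by (rule finite_subset)
    show "irrefl (parcs H)" using H(2) no_loops' by (auto simp: irrefl_def)
    show "sym (parcs H)" using H(2) arcs_symmetric by (auto intro!: symI)
  qed (use H in auto)
qed


section \<open>Graphs all of whose connected induced subgraphs are antipodal\<close>

text \<open>A single vertex is its own antipode. With two vertices, the distance to the other one is
  at least 1, while the distance to the vertex itself is at most 0.\<close>

lemma antipodal_graph_card_le_2:
  assumes G: "pair_graph G" "connected (with_proj G)" and card: "card (pverts G) \<le> 2"
  shows "antipodal_graph G"
proof -
  interpret pair_graph G by fact
  note wf = pair_graph_wf[OF G(1)]
  have "\<exists>!w. antipode G v w" if v: "v \<in> pverts G" for v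
  proof (cases "pverts G = {v}")
    case True
    then show ?thesis by (auto simp: antipode_def)
  next
    case False
    then obtain w where w: "w \<in> pverts G" "w \<noteq> v" using v by blast
    have "card {v, w} = card (pverts G)"
      using card card_mono[OF pair_finite_verts, of "{v, w}"] v w by simp
    then have eq: "pverts G = {v, w}"
      using card_subset_eq[OF pair_finite_verts, of "{v, w}"] v w by simp
    have "graph_dist G v v < 1"
      using graph_dist_self_le[OF wf v] by (rule order_le_less_trans) simp
    moreover have "1 \<le> graph_dist G v w" using w(2) by (intro graph_dist_ge_1[OF wf]) simp
    ultimately have "graph_dist G v v < graph_dist G v w" by (rule order_less_le_trans)
    then have "antipode G v x \<longleftrightarrow> x = w" for x
      by (auto simp: antipode_def eq not_le)
    then show ?thesis by simp
  qed
  then show ?thesis using G by (simp add: antipodal_graph_def)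
qed

text \<open>Take an arc from \<open>a\<close> to \<open>b\<close>, then an arc leaving
  \<open>{a, b}\<close> to some \<open>c\<close>. The centre is whichever of \<open>a\<close> and
  \<open>b\<close> is adjacent to \<open>c\<close>.\<close>

lemma connected_card_ge_3_cherry:
  assumes G: "pair_graph G" "connected (with_proj G)" and card: "card (pverts G) \<ge> 3"
  obtains u v w where "(u, v) \<in> parcs G" "(u, w) \<in> parcs G" "v \<noteq> w"
proof -
  interpret pair_graph G by fact
  obtain a where a: "a \<in> pverts G" using card by fastforce
  have "{a} \<noteq> pverts G" using card by (metis card_1_singleton_iff One_nat_def numeral_le_one_iff semiring_norm(70))
  then obtain b where b: "(a, b) \<in> parcs G" "b \<in> pverts G" "b \<noteq> a"
    using connected_neighbour_outside[OF G, of "{a}"] a by blast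
  have "card {a, b} \<le> 2" by (simp add: card_insert_if)
  then have "{a, b} \<noteq> pverts G" using card by force
  then obtain x c where "x \<in> {a, b}" "c \<in> pverts G - {a, b}" "(x, c) \<in> parcs G"
    using connected_neighbour_outside[OF G, of "{a, b}"] a b(2) by blast
  then show thesis
    using that[of a b c] that[of b a c] b(1) arcs_symmetric[OF b(1)] by blast
qed

lemma cherry_not_all_antipodal:
  assumes G: "pair_graph G" and E: "(u, v) \<in> parcs G" "(u, w) \<in> parcs G" "v \<noteq> w"
  obtains H where "induced_subgraph (with_proj H) (with_proj G)" "connected (with_proj H)"
    "\<not> antipodal_graph H"
proof -
  interpret pair_graph G by fact
  define H where "H = \<lparr>pverts = {u, v, w}, parcs = parcs G \<inter> {u, v, w} \<times> {u, v, w}\<rparr>"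
  have ind: "induced_subgraph (with_proj H) (with_proj G)"
    using E by (auto simp: induced_with_proj_iff[OF pair_wf_digraph] H_def wellformed')
  interpret H: pair_graph H using G ind by (rule induced_pair_graph)
  have EH: "(u, v) \<in> parcs H" "(u, w) \<in> parcs H" "(v, u) \<in> parcs H" "(w, u) \<in> parcs H"
    using E arcs_symmetric by (auto simp: H_def)
  have VH: "pverts H = {u, v, w}" by (simp add: H_def)
  \<comment> \<open>It is left open whether \<open>v\<close> and \<open>w\<close> are adjacent: all
    reachability goes through \<open>u\<close>, and only distances from \<open>u\<close> are
    compared below.\<close>
  have hub: "x \<rightarrow>\<^sup>*\<^bsub>with_proj H\<^esub> u" "u \<rightarrow>\<^sup>*\<^bsub>with_proj H\<^esub> x" if "x \<in> pverts H" for x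
    using that EH VH by (auto intro: H.reachable_adjI)
  have "connected (with_proj H)"
    unfolding pair_graph_connected_iff[OF H.pair_graph]
    using hub H.reachable_trans VH by blast
  moreover have "\<not> antipodal_graph H"
  proof
    assume anti: "antipodal_graph H"
    have ne: "u \<noteq> v" "u \<noteq> w" using E no_loops' by blast+
    have d: "graph_dist H u v = 1" "graph_dist H u w = 1"
      using EH ne graph_dist_adj_le[OF H.pair_wf_digraph] graph_dist_ge_1[OF H.pair_wf_digraph]
      by (auto intro!: antisym)
    \<comment> \<open>\<open>antipode\<close> also compares with the vertex itself, so
      \<open>u\<close> must be shown to be no farther than 1.\<close>
    have "graph_dist H u u \<le> 0"
      using graph_dist_self_le[OF H.pair_wf_digraph] VH by simp
    then have "graph_dist H u u \<le> 1" by (rule order_trans) simp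
    then have "antipode H u v" "antipode H u w"
      using d VH by (auto simp: antipode_def)
    then show False
      using anti VH E(3) by (auto simp: antipodal_graph_def)
  qed
  ultimately show thesis using that ind by blast
qed

section \<open>Isomorphism with the paths on one and two vertices\<close>

lemma digraph_iso_with_proj:
  assumes "pair_wf_digraph G" "inj_on h (pverts G)"
    and "pverts K = h ` pverts G" "parcs K = map_prod h h ` parcs G"
  shows "digraph_iso (with_proj G) (with_proj K)"
proof -
  interpret pair_wf_digraph G by fact
  let ?f = "\<lparr>iso_verts = h, iso_arcs = map_prod h h, iso_head = snd, iso_tail = fst\<rparr>"
  \<comment> \<open>Arcs are pairs of vertices, so an injective vertex map induces an injective arc
    map.\<close>
  have "inj_on (map_prod h h) (parcs G)"
    by (rule inj_on_subset[OF map_prod_inj_on[OF assms(2,2)]])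
      (auto dest: arc_fst_in_verts arc_snd_in_verts)
  then have "pre_digraph.digraph_isomorphism (with_proj G) ?f"
    using assms(2) wf_digraph_axioms by (simp add: digraph_isomorphism_def)
  moreover have "with_proj K = app_iso ?f (with_proj G)"
    using assms(3,4) by (simp add: app_iso_def with_proj_def)
  ultimately show ?thesis unfolding digraph_iso_def by blast
qed

text \<open>The number of vertices is all that the direction from paths to antipodality
  uses.\<close>

lemma digraph_iso_path_graph_card:
  assumes "digraph_iso (with_proj G) (with_proj (path_graph n))"
  shows "card (pverts G) = n"
proof -
  obtain f where f: "pre_digraph.digraph_isomorphism (with_proj G) f"
    "with_proj (path_graph n) = app_iso f (with_proj G)"
    using assms by (auto simp: digraph_iso_def)
  then have "inj_on (iso_verts f) (pverts G)"
    by (simp add: pre_digraph.digraph_isomorphism_def)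
  moreover have "{..<n} = iso_verts f ` pverts G"
    using arg_cong[OF f(2), of verts] by (simp add: path_graph_def verts_app_iso)
  ultimately show ?thesis by (metis card_image card_lessThan)
qed

lemma connected_card_le_2_path_graph:
  assumes G: "pair_graph G" "connected (with_proj G)" and card: "card (pverts G) \<le> 2"
  shows "digraph_iso (with_proj G) (with_proj (path_graph 1)) \<or>
    digraph_iso (with_proj G) (with_proj (path_graph 2))"
proof -
  interpret pair_graph G by fact
  obtain a where a: "a \<in> pverts G"
    using G pair_graph_connected_iff by blast
  show ?thesis
  proof (cases "pverts G = {a}")
    case True
    then have "parcs G = {}" using no_loops' wellformed' by force
    then have "digraph_iso (with_proj G) (with_proj (path_graph 1))"
      using True
      by (intro digraph_iso_with_proj[where h = "\<lambda>_. 0", OF pair_wf_digraph])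
        (auto simp: path_graph_def)
    then show ?thesis ..
  next
    case False
    then obtain b where b: "(a, b) \<in> parcs G" "b \<in> pverts G" "b \<noteq> a"
      using connected_neighbour_outside[OF G, of "{a}"] a by blast
    have "card {a, b} = card (pverts G)"
      using card card_mono[OF pair_finite_verts, of "{a, b}"] a b by simp
    then have V: "pverts G = {a, b}"
      using card_subset_eq[OF pair_finite_verts, of "{a, b}"] a b by simp
    have "parcs G \<subseteq> {(a, b), (b, a)}"
      using V no_loops' wellformed' by fastforce
    then have E: "parcs G = {(a, b), (b, a)}"
      using b(1) arcs_symmetric by blast
    have "digraph_iso (with_proj G) (with_proj (path_graph 2))"
      using V E b(3)
      by (intro digraph_iso_with_proj[where h = "\<lambda>x. if x = a then 0 else 1", OF pair_wf_digraph])
        (auto simp: path_graph_def)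
    then show ?thesis ..
  qed
qed

text \<open>Both sides amount to having at most two vertices, a bound that induced subgraphs
  inherit.\<close>

lemma all_connected_induced_antipodal_iff:
  assumes G: "pair_graph G" "connected (with_proj G)"
  shows "(\<forall>H. induced_subgraph (with_proj H) (with_proj G) \<and> connected (with_proj H)
      \<longrightarrow> antipodal_graph H) \<longleftrightarrow>
    digraph_iso (with_proj G) (with_proj (path_graph 1)) \<or>
    digraph_iso (with_proj G) (with_proj (path_graph 2))" (is "?all \<longleftrightarrow> ?path")
proof
  assume ?all
  then have "card (pverts G) \<le> 2"
    using connected_card_ge_3_cherry[OF G] cherry_not_all_antipodal[OF G(1)]
    by (metis not_less_eq_eq numeral_2_eq_2 numeral_3_eq_3)
  then show ?path by (rule connected_card_le_2_path_graph[OF G])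
next
  interpret pair_graph G by (rule G)
  assume ?path
  then have card: "card (pverts G) \<le> 2"
    using digraph_iso_path_graph_card by force
  show ?all
  proof (intro allI impI, elim conjE)
    fix H assume H: "induced_subgraph (with_proj H) (with_proj G)" "connected (with_proj H)"
    then have "card (pverts H) \<le> card (pverts G)"
      using card_mono[OF pair_finite_verts] induced_with_proj_iff[OF pair_wf_digraph] by blast
    then show "antipodal_graph H"
      using antipodal_graph_card_le_2[OF induced_pair_graph[OF G(1) H(1)] H(2)] card by simp
  qed
qed


section \<open>Embedding into antipodal graphs\<close>

text \<open>A criterion in terms of adjacency only: the candidate \<open>w\<close> is at distance at
  least 3, every other vertex at distance at most 2.\<close>

lemma antipodal_graphI:
  assumes G: "pair_graph G" and ne: "pverts G \<noteq> {}"
    and anti: "\<And>v. v \<in> pverts G \<Longrightarrow> \<exists>w \<in> pverts G. w \<noteq> v \<and> (v, w) \<notin> parcs G \<and>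
      (\<forall>u. (v, u) \<in> parcs G \<longrightarrow> (u, w) \<notin> parcs G) \<and>
      (\<forall>x \<in> pverts G. x = w \<or> x = v \<or> (v, x) \<in> parcs G \<or>
        (\<exists>u. (v, u) \<in> parcs G \<and> (u, x) \<in> parcs G))"
    and nbr: "\<And>v. v \<in> pverts G \<Longrightarrow> \<exists>u. (v, u) \<in> parcs G"
  shows "antipodal_graph G"
proof -
  interpret pair_graph G by fact
  note wf = pair_wf_digraph
  have unique: "\<exists>!w. antipode G v w"
    and reach: "\<forall>x \<in> pverts G. v \<rightarrow>\<^sup>*\<^bsub>with_proj G\<^esub> x" if v: "v \<in> pverts G" for v
  proof -
    obtain w where w: "w \<in> pverts G" "w \<noteq> v" "(v, w) \<notin> parcs G"
      and far: "\<And>u. (v, u) \<in> parcs G \<Longrightarrow> (u, w) \<notin> parcs G"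
      and near: "\<And>x. x \<in> pverts G \<Longrightarrow> x = w \<or> x = v \<or> (v, x) \<in> parcs G \<or>
        (\<exists>u. (v, u) \<in> parcs G \<and> (u, x) \<in> parcs G)"
      using anti[OF v] by metis
    have w_dist: "3 \<le> graph_dist G v w"
      using w far by (intro graph_dist_ge_3[OF wf]) auto
    have other_dist: "graph_dist G v x \<le> 2" if "x \<in> pverts G" "x \<noteq> w" for x
    proof -
      have "x = v \<Longrightarrow> graph_dist G v x \<le> 2"
        using order_trans[OF graph_dist_self_le[OF wf v], of 2] by simp
      moreover have "(v, x) \<in> parcs G \<Longrightarrow> graph_dist G v x \<le> 2"
        using order_trans[OF graph_dist_adj_le[OF wf], of v x 2] by simp
      ultimately show ?thesis
        using near[OF that(1)] that(2) graph_dist_common_neighbour_le[OF wf] by blast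
    qed
    have "graph_dist G v x < graph_dist G v w" if "x \<in> pverts G" "x \<noteq> w" for x
      using other_dist[OF that] order_less_le_trans[OF _ w_dist, of 2]
      by (rule order_le_less_trans) simp
    then have "antipode G v x \<longleftrightarrow> x = w" for x
      unfolding antipode_def using w(1) by (metis order_less_imp_le order_refl not_le)
    then show "\<exists>!w. antipode G v w" by simp
    have reach_other: "v \<rightarrow>\<^sup>*\<^bsub>with_proj G\<^esub> x" if "x \<in> pverts G" "x \<noteq> w" for x
      using near[OF that(1)] that v
      by (auto intro: reachable_adjI reachable_adj_trans)
    \<comment> \<open>The bounds so far allow \<open>w\<close> to be unreachable. A neighbour
      \<open>u\<close> of \<open>w\<close> differs from \<open>w\<close>, hence is reachable from
      \<open>v\<close>, and the walk extends to \<open>w\<close>.\<close>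
    obtain u where u: "(w, u) \<in> parcs G" using nbr w(1) by blast
    have "u \<noteq> w" "u \<in> pverts G" using u no_loops' wellformed' by blast+
    then have "v \<rightarrow>\<^sup>*\<^bsub>with_proj G\<^esub> w"
      using reach_other arcs_symmetric[OF u] by (blast intro: reachable_adj_trans)
    then show "\<forall>x \<in> pverts G. v \<rightarrow>\<^sup>*\<^bsub>with_proj G\<^esub> x" using reach_other by blast
  qed
  then show ?thesis
    using G ne by (simp add: antipodal_graph_def pair_graph_connected_iff)
qed

section \<open>The double of a graph\<close>

fun double_adj :: "('c \<Rightarrow> 'c \<Rightarrow> bool) \<Rightarrow> 'c \<times> bool \<Rightarrow> 'c \<times> bool \<Rightarrow> bool" where
  "double_adj R (x, b) (y, c) \<longleftrightarrow> x \<noteq> y \<and> (R x y \<longleftrightarrow> b = c)"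

text \<open>The map \<open>f\<close> moves the construction to another vertex type, since the
  hereditary hull compares graphs on one fixed type.\<close>

definition relabelled_graph ::
    "('c \<Rightarrow> 'b) \<Rightarrow> 'c set \<Rightarrow> ('c \<Rightarrow> 'c \<Rightarrow> bool) \<Rightarrow> 'b pair_pre_digraph" where
  "relabelled_graph f X R =
     \<lparr>pverts = f ` X, parcs = {(f x, f y) | x y. x \<in> X \<and> y \<in> X \<and> R x y}\<rparr>"

lemma relabelled_graph_arc_iff:
  assumes "inj_on f X" "x \<in> X" "y \<in> X"
  shows "(f x, f y) \<in> parcs (relabelled_graph f X R) \<longleftrightarrow> R x y"
proof
  assume "(f x, f y) \<in> parcs (relabelled_graph f X R)"
  then obtain x' y' where "f x = f x'" "f y = f y'" "x' \<in> X" "y' \<in> X" "R x' y'"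
    by (auto simp: relabelled_graph_def)
  then show "R x y" using assms by (metis inj_onD)
next
  assume "R x y"
  then show "(f x, f y) \<in> parcs (relabelled_graph f X R)"
    using assms(2,3) unfolding relabelled_graph_def by auto
qed

text \<open>Call the boolean component the sheet: a step stays in its sheet iff \<open>R\<close>
  relates the two first components. As \<open>R\<close> is symmetric, stepping from \<open>x\<close>
  to \<open>y\<close> and back returns to the same sheet, so \<open>(x, \<not> b)\<close> is not
  reached in two steps. The condition \<open>split\<close> says that, for \<open>x\<close> and
  \<open>y\<close> distinct, some route through \<open>u\<close> ends at the copy of
  \<open>y\<close> not adjacent to the starting copy of \<open>x\<close>.\<close>

lemma antipodal_double:
  fixes Y :: "'c set" and f :: "'c \<times> bool \<Rightarrow> 'b"
  assumes fin: "finite Y" and sym: "\<And>x y. R x y \<longleftrightarrow> R y x"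
    and two: "x0 \<in> Y" "x1 \<in> Y" "x0 \<noteq> x1"
    and split: "\<And>x y. x \<in> Y \<Longrightarrow> y \<in> Y \<Longrightarrow> x \<noteq> y \<Longrightarrow>
      \<exists>u \<in> Y. u \<noteq> x \<and> u \<noteq> y \<and> ((R x u \<longleftrightarrow> R u y) \<longleftrightarrow> \<not> R x y)"
    and inj: "inj_on f (Y \<times> UNIV)"
  shows "antipodal_graph (relabelled_graph f (Y \<times> UNIV) (double_adj R))"
    (is "antipodal_graph ?A")
proof (rule antipodal_graphI)
  have V: "pverts ?A = f ` (Y \<times> UNIV)" by (simp add: relabelled_graph_def)
  have E: "(f (x, b), f (y, c)) \<in> parcs ?A \<longleftrightarrow> x \<noteq> y \<and> (R x y \<longleftrightarrow> b = c)"
    if "x \<in> Y" "y \<in> Y" for x y b c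
    using relabelled_graph_arc_iff[OF inj, of "(x, b)" "(y, c)"] that by simp
  have EV: "parcs ?A \<subseteq> pverts ?A \<times> pverts ?A"
    by (auto simp: relabelled_graph_def)
  show "pair_graph ?A"
  proof (rule pair_graphI)
    show "finite (pverts ?A)" using fin V by simp
    show "irrefl (parcs ?A)"
      unfolding irrefl_def
    proof
      fix v show "(v, v) \<notin> parcs ?A"
      proof
        assume vv: "(v, v) \<in> parcs ?A"
        then obtain x b where "x \<in> Y" "v = f (x, b)" using EV V by auto
        then show False using vv E by simp
      qed
    qed
    show "Relation.sym (parcs ?A)"
    proof (rule symI)
      fix v w assume vw: "(v, w) \<in> parcs ?A"
      then obtain x b y c where "x \<in> Y" "v = f (x, b)" "y \<in> Y" "w = f (y, c)"
        using EV V by blast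
      then show "(w, v) \<in> parcs ?A" using vw E sym by auto
    qed
  qed (rule EV)
  show "pverts ?A \<noteq> {}" using two(1) V by blast
  fix v assume "v \<in> pverts ?A"
  then obtain x b where x: "x \<in> Y" and v: "v = f (x, b)" using V by auto
  show "\<exists>u. (v, u) \<in> parcs ?A"
  proof -
    obtain y where "y \<in> Y" "y \<noteq> x" using two by metis
    \<comment> \<open>The boolean \<open>b = R x y\<close> is the sheet in which
      \<open>(x, b)\<close> has its unique neighbour over \<open>y\<close>.\<close>
    then have "(v, f (y, b = R x y)) \<in> parcs ?A" using E x v by auto
    then show ?thesis ..
  qed
  show "\<exists>w \<in> pverts ?A. w \<noteq> v \<and> (v, w) \<notin> parcs ?A \<and>
      (\<forall>u. (v, u) \<in> parcs ?A \<longrightarrow> (u, w) \<notin> parcs ?A) \<and>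
      (\<forall>z \<in> pverts ?A. z = w \<or> z = v \<or> (v, z) \<in> parcs ?A \<or>
        (\<exists>u. (v, u) \<in> parcs ?A \<and> (u, z) \<in> parcs ?A))"
  proof (intro bexI[of _ "f (x, \<not> b)"] conjI allI ballI impI)
    show "f (x, \<not> b) \<noteq> v" using inj_onD[OF inj, of "(x, \<not> b)" "(x, b)"] x v by auto
    show "(v, f (x, \<not> b)) \<notin> parcs ?A" using E x v by simp
    show "f (x, \<not> b) \<in> pverts ?A" using x V by simp
  next
    fix u assume vu: "(v, u) \<in> parcs ?A"
    then obtain y c where "y \<in> Y" "u = f (y, c)" using EV V by auto
    then show "(u, f (x, \<not> b)) \<notin> parcs ?A" using vu E x v sym by auto
  next
    fix z assume "z \<in> pverts ?A"
    then obtain y c where y: "y \<in> Y" and z: "z = f (y, c)" using V by auto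
    show "z = f (x, \<not> b) \<or> z = v \<or> (v, z) \<in> parcs ?A \<or>
      (\<exists>u. (v, u) \<in> parcs ?A \<and> (u, z) \<in> parcs ?A)"
    \<comment> \<open>The true case covers \<open>v\<close>, its antipode and its neighbours; only
      the non-adjacent copies over other vertices need the detour through \<open>u\<close>.\<close>
    proof (cases "x = y \<or> (R x y \<longleftrightarrow> b = c)")
      case True
      then show ?thesis using E[OF x y, of b c] v z by (cases b; cases c) auto
    next
      case False
      then obtain u where "u \<in> Y" "u \<noteq> x" "u \<noteq> y" "(R x u \<longleftrightarrow> R u y) \<longleftrightarrow> \<not> R x y"
        using split[OF x y] by blast
      then have "(v, f (u, b = R x u)) \<in> parcs ?A" "(f (u, b = R x u), z) \<in> parcs ?A"
        using False E x y v z by auto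
      then show ?thesis by blast
    qed
  qed
qed

section \<open>Enlarging a graph to satisfy the splitting condition\<close>

datatype 'a extended_vertex = Base 'a | Pendant 'a | Apex

fun extended_adj :: "'a rel \<Rightarrow> 'a extended_vertex \<Rightarrow> 'a extended_vertex \<Rightarrow> bool" where
  "extended_adj E (Base v) (Base w) \<longleftrightarrow> (v, w) \<in> E"
| "extended_adj E (Base v) (Pendant w) \<longleftrightarrow> v = w"
| "extended_adj E (Pendant v) (Base w) \<longleftrightarrow> v = w"
| "extended_adj E (Pendant v) (Pendant w) \<longleftrightarrow> v \<noteq> w"
| "extended_adj E (Base v) Apex \<longleftrightarrow> True"
| "extended_adj E Apex (Base v) \<longleftrightarrow> True"
| "extended_adj E _ _ \<longleftrightarrow> False"

lemma extended_adj_sym: "sym E \<Longrightarrow> extended_adj E x y \<longleftrightarrow> extended_adj E y x"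
  by (cases x; cases y) (simp_all, (metis symD)+)

text \<open>The witness \<open>u\<close> must be adjacent to exactly one of \<open>x\<close>,
  \<open>y\<close> if these are adjacent, and to both or neither otherwise. A pendant vertex
  separates adjacent base vertices, and \<open>Apex\<close> joins non-adjacent ones; the remaining
  pairs are handled by \<open>Apex\<close> or by the partner of one of the two.\<close>

lemma extended_adj_split:
  fixes V :: "'a set"
  defines "Y \<equiv> insert Apex (Base ` V \<union> Pendant ` V)"
  assumes "x \<in> Y" "y \<in> Y" "x \<noteq> y"
  shows "\<exists>u \<in> Y. u \<noteq> x \<and> u \<noteq> y \<and>
    ((extended_adj E x u \<longleftrightarrow> extended_adj E u y) \<longleftrightarrow> \<not> extended_adj E x y)"
proof (cases x)
  case x: (Base v)
  show ?thesis
  proof (cases y)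
    case y: (Base w)
    show ?thesis
      using assms x y
      by (cases "(v, w) \<in> E") (auto intro: bexI[of _ "Pendant v"] bexI[of _ Apex])
  next
    case y: (Pendant w)
    show ?thesis
      using assms x y
      by (cases "v = w") (auto intro: bexI[of _ "Pendant v"] bexI[of _ Apex])
  next
    case y: Apex
    show ?thesis using assms x y by (auto intro: bexI[of _ "Pendant v"])
  qed
next
  case x: (Pendant v)
  show ?thesis
  proof (cases y)
    case y: (Base w)
    show ?thesis
      using assms x y
      by (cases "v = w") (auto intro: bexI[of _ "Pendant w"] bexI[of _ Apex])
  next
    case y: (Pendant w)
    show ?thesis using assms x y by (auto intro: bexI[of _ "Base v"])
  next
    case y: Apex
    show ?thesis using assms x y by (auto intro: bexI[of _ "Base v"])
  qed
next
  case x: Apex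
  show ?thesis
  proof (cases y)
    case y: (Base w)
    show ?thesis using assms x y by (auto intro: bexI[of _ "Pendant w"])
  next
    case y: (Pendant w)
    show ?thesis using assms x y by (auto intro: bexI[of _ "Base w"])
  qed (use assms x in simp)
qed

text \<open>The values on the embedded copy of \<open>V\<close> are prescribed by \<open>h\<close>;
  all other points are sent to values from a strict upper bound \<open>m\<close> of \<open>h\<close>
  on \<open>V\<close> onwards.\<close>

lemma inj_on_nat_extend:
  fixes h :: "'a \<Rightarrow> nat"
  assumes "finite X" "finite V" "inj_on h V" "inj i"
  obtains f where "inj_on f X" "\<And>v. v \<in> V \<Longrightarrow> f (i v) = h v"
proof -
  obtain g :: "'b \<Rightarrow> nat" where g: "inj_on g X"
    using finite_imp_inj_to_nat_seg[OF assms(1)] by blast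
  obtain m where m: "\<And>v. v \<in> V \<Longrightarrow> h v < m"
    using assms(2) by (metis finite_imageI finite_nat_set_iff_bounded imageI)
  define f where "f x = (if x \<in> i ` V then h (the_inv i x) else m + g x)" for x
  have fi: "f (i v) = h v" if "v \<in> V" for v
    using that assms(4) by (simp add: f_def the_inv_f_f)
  have "inj_on f X"
  proof (rule inj_onI)
    fix x y assume xy: "x \<in> X" "y \<in> X" "f x = f y"
    \<comment> \<open>The threshold \<open>m\<close> lets membership in the embedded copy be read
      off the value of \<open>f\<close>, so no collision occurs between the two kinds of
      points.\<close>
    have small: "z \<in> i ` V \<longleftrightarrow> f z < m" for z
      using m fi by (auto simp: f_def)
    show "x = y"
    proof (cases "x \<in> i ` V")
      case True
      then have "y \<in> i ` V" using small xy(3) by simp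
      with True obtain v w where "v \<in> V" "x = i v" "w \<in> V" "y = i w" by blast
      then show ?thesis using xy(3) fi assms(3) by (metis inj_onD)
    next
      case False
      then have "y \<notin> i ` V" using small xy(3) by simp
      then show ?thesis using False xy inj_onD[OF g] by (simp add: f_def)
    qed
  qed
  then show thesis using that fi by blast
qed

text \<open>Keeping \<open>h\<close> arbitrary serves two uses: an isomorphic copy of a graph on any
  type, and, with \<open>h\<close> the identity, a graph on \<open>nat\<close> itself.\<close>

lemma relabelled_copy_in_antipodal_graph:
  fixes G :: "'a pair_pre_digraph" and h :: "'a \<Rightarrow> nat"
  assumes G: "pair_graph G" "pverts G \<noteq> {}" and h: "inj_on h (pverts G)"
  obtains A where "antipodal_graph A"
    "induced_subgraph
       (with_proj \<lparr>pverts = h ` pverts G, parcs = map_prod h h ` parcs G\<rparr>) (with_proj A)"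
proof -
  interpret pair_graph G by fact
  define V where "V = pverts G"
  define Y where "Y = insert Apex (Base ` V \<union> Pendant ` V)"
  let ?R = "extended_adj (parcs G)"
  have finV: "finite V" by (simp add: V_def pair_finite_verts)
  then have finY: "finite Y" by (simp add: Y_def)
  then have "finite (Y \<times> (UNIV :: bool set))" by simp
  moreover have "inj (\<lambda>v. (Base v, True))" by (auto intro: injI)
  ultimately obtain f where f: "inj_on f (Y \<times> UNIV)" "\<And>v. v \<in> V \<Longrightarrow> f (Base v, True) = h v"
    using inj_on_nat_extend[OF _ finV h[folded V_def]] by blast
  let ?A = "relabelled_graph f (Y \<times> UNIV) (double_adj ?R)"
  obtain a where "a \<in> V" using G(2) V_def by blast
  then have "Apex \<in> Y" "Base a \<in> Y" by (auto simp: Y_def)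
  moreover have "Relation.sym (parcs G)" using arcs_symmetric by (auto intro: symI)
  ultimately have A: "antipodal_graph ?A"
    using extended_adj_split[of _ V _ "parcs G", folded Y_def] f(1)
    by (intro antipodal_double[OF finY extended_adj_sym, of _ Apex "Base a"]) simp_all
  \<comment> \<open>Within one sheet the double agrees with \<open>?R\<close> off the diagonal, and
    \<open>G\<close> has no loops, so the base vertices in sheet \<open>True\<close> induce a copy
    of \<open>G\<close>.\<close>
  have arc: "(h v, h w) \<in> parcs ?A \<longleftrightarrow> (v, w) \<in> parcs G" if "v \<in> V" "w \<in> V" for v w
  proof -
    have "(f (Base v, True), f (Base w, True)) \<in> parcs ?A \<longleftrightarrow> (v, w) \<in> parcs G"
      using relabelled_graph_arc_iff[OF f(1), of "(Base v, True)" "(Base w, True)"] that no_loops'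
      by (auto simp: Y_def)
    then show ?thesis using f(2) that by simp
  qed
  have "h ` V \<subseteq> pverts ?A"
  proof
    fix n assume "n \<in> h ` V"
    then obtain v where "v \<in> V" "n = f (Base v, True)" using f(2) by auto
    then show "n \<in> pverts ?A" by (auto simp: relabelled_graph_def Y_def)
  qed
  moreover have "map_prod h h ` parcs G = parcs ?A \<inter> h ` V \<times> h ` V"
    using arc wellformed' by (fastforce simp: V_def)
  ultimately have "induced_subgraph
      (with_proj \<lparr>pverts = h ` V, parcs = map_prod h h ` parcs G\<rparr>) (with_proj ?A)"
    using A by (subst induced_with_proj_iff) (auto simp: antipodal_graph_def pair_graph_wf)
  then show thesis using that A V_def by blast
qed

theorem theorem6:
  shows
    "(\<forall>G :: 'a pair_pre_digraph. pair_graph G \<and> connected (with_proj G) \<longrightarrow>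
        ((\<forall>H :: 'a pair_pre_digraph. induced_subgraph (with_proj H) (with_proj G) \<and> connected (with_proj H)
           \<longrightarrow> antipodal_graph H)
         \<longleftrightarrow> digraph_iso (with_proj G) (with_proj (path_graph 1)) \<or>
             digraph_iso (with_proj G) (with_proj (path_graph 2))))
     \<and> (\<forall>G :: 'a pair_pre_digraph. pair_graph G \<and> connected (with_proj G) \<longrightarrow>
          (\<exists>A K :: nat pair_pre_digraph.
             antipodal_graph A \<and> induced_subgraph (with_proj K) (with_proj A) \<and> digraph_iso (with_proj G) (with_proj K)))
     \<and> {G :: nat pair_pre_digraph. pair_graph G \<and> connected (with_proj G)}
         \<subseteq> hereditary hull {A. antipodal_graph A}"
proof (intro conjI allI impI subsetI)
  fix G :: "'a pair_pre_digraph" assume "pair_graph G \<and> connected (with_proj G)"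
  then show "(\<forall>H :: 'a pair_pre_digraph.
        induced_subgraph (with_proj H) (with_proj G) \<and> connected (with_proj H)
          \<longrightarrow> antipodal_graph H) \<longleftrightarrow>
      digraph_iso (with_proj G) (with_proj (path_graph 1)) \<or>
      digraph_iso (with_proj G) (with_proj (path_graph 2))"
    using all_connected_induced_antipodal_iff by blast
next
  fix G :: "'a pair_pre_digraph" assume "pair_graph G \<and> connected (with_proj G)"
  then have G: "pair_graph G" "pverts G \<noteq> {}" using pair_graph_connected_iff by auto
  interpret pair_graph G by (rule G)
  \<comment> \<open>The type \<open>'a\<close> may have too few elements to hold the enlarged graph,
    so a copy on \<open>nat\<close> is used.\<close>
  obtain h :: "'a \<Rightarrow> nat" where h: "inj_on h (pverts G)"
    using finite_imp_inj_to_nat_seg[OF pair_finite_verts] by blast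
  let ?K = "\<lparr>pverts = h ` pverts G, parcs = map_prod h h ` parcs G\<rparr>"
  have "digraph_iso (with_proj G) (with_proj ?K)"
    using h by (intro digraph_iso_with_proj[OF pair_wf_digraph]) simp_all
  then show "\<exists>A K :: nat pair_pre_digraph. antipodal_graph A \<and>
      induced_subgraph (with_proj K) (with_proj A) \<and> digraph_iso (with_proj G) (with_proj K)"
    using relabelled_copy_in_antipodal_graph[OF G h] by blast
next
  fix G :: "nat pair_pre_digraph"
  assume "G \<in> {G. pair_graph G \<and> connected (with_proj G)}"
  then have G: "pair_graph G" "pverts G \<noteq> {}" using pair_graph_connected_iff by auto
  \<comment> \<open>\<open>hereditary\<close> does not include closure under isomorphism, so
    \<open>G\<close> itself, not merely a copy, has to be induced in \<open>A\<close>.\<close>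
  have "\<lparr>pverts = id ` pverts G, parcs = map_prod id id ` parcs G\<rparr> = G"
    by (simp add: map_prod.id)
  then obtain A where "antipodal_graph A" "induced_subgraph (with_proj G) (with_proj A)"
    using relabelled_copy_in_antipodal_graph[OF G inj_on_id] by metis
  moreover have "A \<in> hereditary hull {A. antipodal_graph A}"
    using \<open>antipodal_graph A\<close> by (intro subsetD[OF hull_subset]) simp
  ultimately show "G \<in> hereditary hull {A. antipodal_graph A}"
    using hereditary_hull[of "{A. antipodal_graph A}"] unfolding hereditary_def by blast
qed

end
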